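(* Let $k$ be a field and $Q$ a quiver. Then there are isomorphisms of representations of $L_k(Q)$ $$\mathcal{F}_{[p]}\simeq\mathcal{M}([p])\quad\text{and}\quad\mathcal{N}_i\simeq\mathcal{M}(N_i)$$ for each left-infinite path $p$ and each sink $i$ in $Q$.
   Context: A quiver $Q=(Q_0,Q_1;s,t)$ consists of a set $Q_0$ of vertices, a set $Q_1$ of arrows and maps $s,t\colon Q_1\to Q_0$ (starting and terminating vertex). A vertex is a sink if no arrow starts at it, an infinite emitter if infinitely many arrows start at it, and regular if it is neither. A finite path of length $n\ge1$ is a sequence $p=\alpha_n\cdots\alpha_2\alpha_1$ of arrows with $t(\alpha_i)=s(\alpha_{i+1})$; $s(p)=s(\alpha_1)$, $t(p)=t(\alpha_n)$ (it starts with $\alpha_1$); for each vertex $i$ there is a trivial path $e_i$ of length $0$ with $s(e_i)=t(e_i)=i$. Concatenation is written from right to left. Leavitt path algebra: $L_k(Q)$ is the $k$-algebra (algebras are not required to be unital) given by generators $\{e_i,\alpha,\alpha^*\mid i\in Q_0,\alpha\in Q_1\}$ subject to: (0) $e_ie_j=\delta_{ij}e_i$ for $i,j\in Q_0$; (1) $e_{t(\alpha)}\alpha=\alpha=\alpha e_{s(\alpha)}$; (2) $e_{s(\alpha)}\alpha^*=\alpha^*=\alpha^*e_{t(\alpha)}$; (3) $\alpha\beta^*=\delta_{\alpha,\beta}e_{t(\alpha)}$ for $\alpha,\beta\in Q_1$; (4) $\sum_{\{\alpha\in Q_1\mid s(\alpha)=i\}}\alpha^*\alpha=e_i$ for every regular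 vertex $i$. A representation is a $k$-vector space $M$ with an algebra homomorphism $L_k(Q)\to{\rm End}_k(M)$. A left-infinite path is an infinite sequence $p=\cdots\alpha_n\cdots\alpha_2\alpha_1$ of arrows with $t(\alpha_i)=s(\alpha_{i+1})$ for all $i\ge1$; $s(p)=s(\alpha_1)$ (it starts with $\alpha_1$); $Q_\infty$ is the set of them. For $n\ge0$, $\tau_{>n}(p)=\cdots\alpha_{n+2}\alpha_{n+1}$. Left-infinite paths $p,q$ are tail-equivalent if $\tau_{>n}(p)=\tau_{>m}(q)$ for some $n,m\ge0$; $[p]$ is the class of $p$. $\mathcal{F}$ is the $k$-vector space with basis $Q_\infty$, with $L_k(Q)$-action, for $p=\cdots\alpha_2\alpha_1$: $e_i.p=\delta_{i,s(p)}p$; $\alpha.p=\delta_{\alpha,\alpha_1}\tau_{>1}(p)$; $\alpha^*.p=p\alpha$ if $t(\alpha)=s(p)$ and $0$ otherwise. $\mathcal{F}_{[p]}$ is the subrepresentation spanned by $\{q\mid q\in[p]\}$. $\mathcal{N}$ is the $k$-vector space with basis the finite paths terminating at a sink (trivial paths at sinks included), with action: $e_i.p=\delta_{i,s(p)}p$; $\alpha.p=0$ if $p$ has length $0$, and $\alpha.p=\delta_{\alpha,\alpha_1}\,\alpha_n\cdots\alpha_2$ for $p=\alpha_n\cdots\alpha_2\alpha_1$ (read as $e_{t(\alpha_1)}$ when $n=1$); $\alpha^*.p=p\alpha$ if $t(\alpha)=s(p)$ and $0$ otherwise. For a sink $i$, $\mathcal{N}_i$ is the subrepresentation spanned by the paths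 $p$ with $t(p)=i$. A $Q$-algebraic branching system consists of a set $X$, a family of subsets $\{X_i,X_\alpha\mid i\in Q_0,\alpha\in Q_1\}$ of $X$, and a bijection $\sigma_\alpha\colon X_{t(\alpha)}\to X_\alpha$ for each arrow $\alpha$, such that: (1) $X_i\cap X_j=\emptyset=X_\alpha\cap X_\beta$ for $i\ne j$, $\alpha\ne\beta$; (2) $X_\alpha\subseteq X_{s(\alpha)}$ for each $\alpha\in Q_1$; (3) $X_i=\bigcup_{\{\alpha\in Q_1\mid s(\alpha)=i\}}X_\alpha$ for each regular vertex $i$. Its associated representation $\mathcal{M}(X)$ is the $k$-vector space of all functions $X\to k$ vanishing on all but finitely many elements, with basis the characteristic functions $\chi_x$, $x\in X$, and action: $e_i.\chi_x=\chi_x$ if $x\in X_i$, and $0$ otherwise; $\alpha.\chi_x=\chi_{\sigma_\alpha^{-1}(x)}$ if $x\in X_\alpha$, and $0$ otherwise; $\alpha^*.\chi_x=\chi_{\sigma_\alpha(x)}$ if $x\in X_{t(\alpha)}$, and $0$ otherwise. For a left-infinite path $p$, the set $[p]$ is a $Q$-algebraic branching system with $[p]_i=\{q\in[p]\mid s(q)=i\}$, $[p]_\alpha=\{q\in[p]\mid q\text{ starts with }\alpha\}$, and $\sigma_\alpha(q)=q\alpha$. For a sink $i$, $N_i$ is the set of finite paths terminating at $i$ (including $e_i$), a $Q$-algebraic branching system with $(N_i)_j=\{q\in N_i\mid s(q)=j\}$, $(N_i)_\alpha=\{q\in N_i\mid q\text{ starts with }\alpha\}$, and $\sigma_\alpha(q)=q\alpha$.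 *)

theory Defs
  imports
    "HOL-Library.FuncSet"
    "HOL-Library.Poly_Mapping"
    "HOL-Library.Stream"
    "Graph_Theory.Arc_Walk"
begin

section \<open>Quivers\<close>

text \<open>
  A quiver is a \<^locale>\<open>wf_digraph\<close>: a carrier set of vertices and one of arrows, both of arbitrary
  cardinality, loops and parallel arrows being allowed. The starting vertex of an arrow is its
  \<^const>\<open>tail\<close>, the terminating vertex its \<^const>\<open>head\<close>.
\<close>

definition is_sink :: "('v, 'a) pre_digraph \<Rightarrow> 'v \<Rightarrow> bool" where
  "is_sink Q i \<longleftrightarrow> i \<in> verts Q \<and> out_arcs Q i = {}"

definition infinite_emitter :: "('v, 'a) pre_digraph \<Rightarrow> 'v \<Rightarrow> bool" where
  "infinite_emitter Q i \<longleftrightarrow> i \<in> verts Q \<and> infinite (out_arcs Q i)"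

definition regular :: "('v, 'a) pre_digraph \<Rightarrow> 'v \<Rightarrow> bool" where
  "regular Q i \<longleftrightarrow> i \<in> verts Q \<and> \<not> is_sink Q i \<and> \<not> infinite_emitter Q i"

subsection \<open>Finite paths\<close>

text \<open>
  The path \<open>\<alpha>\<^sub>n \<cdots> \<alpha>\<^sub>1\<close> is the pair of its starting vertex and the list \<open>[\<alpha>\<^sub>1, \<dots>, \<alpha>\<^sub>n]\<close>. The first
  component matters only for the trivial path \<open>e\<^sub>i = (i, [])\<close>. Paths are composed from right to left,
  so \<open>p\<alpha>\<close> is obtained by consing \<open>\<alpha>\<close> to the list.
\<close>

type_synonym ('v, 'a) fpath = "'v \<times> 'a list"

definition finite_paths_to :: "('v, 'a) pre_digraph \<Rightarrow> 'v \<Rightarrow> ('v, 'a) fpath set" where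
  "finite_paths_to Q i = {p. pre_digraph.awalk Q (fst p) (snd p) i}"

subsection \<open>Left-infinite paths\<close>

text \<open>
  The left-infinite path \<open>\<cdots> \<alpha>\<^sub>2 \<alpha>\<^sub>1\<close> is the stream \<open>\<alpha>\<^sub>1, \<alpha>\<^sub>2, \<dots>\<close>, indexed from 0. Thus \<open>\<tau>\<^bsub>>n\<^esub>(p)\<close> is
  \<^term>\<open>sdrop n p\<close>, and \<open>p\<alpha>\<close> is \<^term>\<open>\<alpha> ## p\<close>.
\<close>

definition left_infinite_paths :: "('v, 'a) pre_digraph \<Rightarrow> 'a stream set" where
  "left_infinite_paths Q =
     {p. \<forall>n. p !! n \<in> arcs Q \<and> head Q (p !! n) = tail Q (p !! Suc n)}"

definition tail_equivalent :: "'a stream \<Rightarrow> 'a stream \<Rightarrow> bool" where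
  "tail_equivalent p q \<longleftrightarrow> (\<exists>n m. sdrop n p = sdrop m q)"

definition tail_class :: "('v, 'a) pre_digraph \<Rightarrow> 'a stream \<Rightarrow> 'a stream set" where
  "tail_class Q p = {q \<in> left_infinite_paths Q. tail_equivalent p q}"


section \<open>Algebras without unit\<close>

record ('k, 'b) algebra =
  acarrier :: "'b set"
  aadd :: "'b \<Rightarrow> 'b \<Rightarrow> 'b"
  amult :: "'b \<Rightarrow> 'b \<Rightarrow> 'b"
  ascale :: "'k \<Rightarrow> 'b \<Rightarrow> 'b"

definition algebra_hom :: "('k, 'b) algebra \<Rightarrow> ('k, 'c) algebra \<Rightarrow> ('b \<Rightarrow> 'c) \<Rightarrow> bool" where
  "algebra_hom A B h \<longleftrightarrow>
     h \<in> acarrier A \<rightarrow> acarrier B \<and>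
     (\<forall>x\<in>acarrier A. \<forall>y\<in>acarrier A. h (aadd A x y) = aadd B (h x) (h y)) \<and>
     (\<forall>x\<in>acarrier A. \<forall>y\<in>acarrier A. h (amult A x y) = amult B (h x) (h y)) \<and>
     (\<forall>c. \<forall>x\<in>acarrier A. h (ascale A c x) = ascale B c (h x))"


section \<open>The Leavitt path algebra\<close>

datatype ('v, 'a) gen = Vert 'v | Arr 'a | Ghost 'a

definition gens :: "('v, 'a) pre_digraph \<Rightarrow> ('v, 'a) gen set" where
  "gens Q = Vert ` verts Q \<union> Arr ` arcs Q \<union> Ghost ` arcs Q"

text \<open>
  The free monoid, written additively: convolution then makes
  \<open>'g free_monoid \<Rightarrow>\<^sub>0 'k\<close> the free unital algebra on \<open>'g\<close>.
\<close>

datatype 'g free_monoid = Word (letters: "'g list")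

instantiation free_monoid :: (type) monoid_add
begin

definition zero_free_monoid :: "'a free_monoid" where
  "0 = Word []"

definition plus_free_monoid :: "'a free_monoid \<Rightarrow> 'a free_monoid \<Rightarrow> 'a free_monoid" where
  "u + v = Word (letters u @ letters v)"

instance
  by standard (simp_all add: zero_free_monoid_def plus_free_monoid_def)

end

definition fscale :: "'k::field \<Rightarrow> ('x \<Rightarrow>\<^sub>0 'k) \<Rightarrow> ('x \<Rightarrow>\<^sub>0 'k)" where
  "fscale c f = Poly_Mapping.map ((*) c) f"

type_synonym ('v, 'a, 'k) free_alg = "('v, 'a) gen free_monoid \<Rightarrow>\<^sub>0 'k"

text \<open>
  The free non-unital algebra on the generators of \<open>Q\<close>: only non-empty words occur.
\<close>

definition free_carrier :: "('v, 'a) pre_digraph \<Rightarrow> ('v, 'a, 'k::field) free_alg set" where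
  "free_carrier Q = {a. \<forall>w\<in>Poly_Mapping.keys a. letters w \<noteq> [] \<and> set (letters w) \<subseteq> gens Q}"

definition mon :: "('v, 'a) gen list \<Rightarrow> ('v, 'a, 'k::field) free_alg" where
  "mon gs = Poly_Mapping.single (Word gs) 1"

inductive_set relators :: "('v, 'a) pre_digraph \<Rightarrow> ('v, 'a, 'k::field) free_alg set"
  for Q :: "('v, 'a) pre_digraph" where
  rel_vert: "\<lbrakk>i \<in> verts Q; j \<in> verts Q\<rbrakk> \<Longrightarrow>
    mon [Vert i, Vert j] - (if i = j then mon [Vert i] else 0) \<in> relators Q"
| rel_arr_left: "\<alpha> \<in> arcs Q \<Longrightarrow>
    mon [Vert (head Q \<alpha>), Arr \<alpha>] - mon [Arr \<alpha>] \<in> relators Q"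
| rel_arr_right: "\<alpha> \<in> arcs Q \<Longrightarrow>
    mon [Arr \<alpha>, Vert (tail Q \<alpha>)] - mon [Arr \<alpha>] \<in> relators Q"
| rel_ghost_left: "\<alpha> \<in> arcs Q \<Longrightarrow>
    mon [Vert (tail Q \<alpha>), Ghost \<alpha>] - mon [Ghost \<alpha>] \<in> relators Q"
| rel_ghost_right: "\<alpha> \<in> arcs Q \<Longrightarrow>
    mon [Ghost \<alpha>, Vert (head Q \<alpha>)] - mon [Ghost \<alpha>] \<in> relators Q"
| rel_CK1: "\<lbrakk>\<alpha> \<in> arcs Q; \<beta> \<in> arcs Q\<rbrakk> \<Longrightarrow>
    mon [Arr \<alpha>, Ghost \<beta>] - (if \<alpha> = \<beta> then mon [Vert (head Q \<alpha>)] else 0) \<in> relators Q"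
| rel_CK2: "regular Q i \<Longrightarrow>
    (\<Sum>\<alpha>\<in>out_arcs Q i. mon [Ghost \<alpha>, Arr \<alpha>]) - mon [Vert i] \<in> relators Q"

text \<open>The two-sided ideal generated by the relators.\<close>

inductive_set leavitt_ideal :: "('v, 'a) pre_digraph \<Rightarrow> ('v, 'a, 'k::field) free_alg set"
  for Q :: "('v, 'a) pre_digraph" where
  ideal_zero: "0 \<in> leavitt_ideal Q"
| ideal_rel: "r \<in> relators Q \<Longrightarrow> r \<in> leavitt_ideal Q"
| ideal_add: "\<lbrakk>a \<in> leavitt_ideal Q; b \<in> leavitt_ideal Q\<rbrakk> \<Longrightarrow> a + b \<in> leavitt_ideal Q"
| ideal_scale: "a \<in> leavitt_ideal Q \<Longrightarrow> fscale c a \<in> leavitt_ideal Q"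
| ideal_mult_left: "\<lbrakk>x \<in> free_carrier Q; a \<in> leavitt_ideal Q\<rbrakk> \<Longrightarrow> x * a \<in> leavitt_ideal Q"
| ideal_mult_right: "\<lbrakk>x \<in> free_carrier Q; a \<in> leavitt_ideal Q\<rbrakk> \<Longrightarrow> a * x \<in> leavitt_ideal Q"

definition leavitt_rel ::
  "('v, 'a) pre_digraph \<Rightarrow> (('v, 'a, 'k::field) free_alg \<times> ('v, 'a, 'k) free_alg) set" where
  "leavitt_rel Q = {(a, b). a \<in> free_carrier Q \<and> b \<in> free_carrier Q \<and> a - b \<in> leavitt_ideal Q}"

text \<open>
  The quotient algebra. Each union below is that of a single class, namely the class of the
  result computed on arbitrary representatives.
\<close>

definition leavitt_path_algebra ::
  "('v, 'a) pre_digraph \<Rightarrow> ('k::field, ('v, 'a, 'k) free_alg set) algebra" where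
  "leavitt_path_algebra Q =
     \<lparr>acarrier = free_carrier Q // leavitt_rel Q,
      aadd = \<lambda>C D. \<Union>a\<in>C. \<Union>b\<in>D. leavitt_rel Q `` {a + b},
      amult = \<lambda>C D. \<Union>a\<in>C. \<Union>b\<in>D. leavitt_rel Q `` {a * b},
      ascale = \<lambda>c C. \<Union>a\<in>C. leavitt_rel Q `` {fscale c a}\<rparr>"


section \<open>Representations\<close>

text \<open>
  The vector space of a representation is a subspace of an ambient vector space, which is given by
  a scalar multiplication on a whole type. The action maps elements of the Leavitt path algebra
  (that is, classes) to functions which are \<^const>\<open>undefined\<close> outside that subspace, so that
  endomorphisms agreeing on the subspace are equal.
\<close>

record ('k, 'l, 'm) algebra_action =
  vscale :: "'k \<Rightarrow> 'm \<Rightarrow> 'm"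
  vspace :: "'m set"
  act :: "'l \<Rightarrow> 'm \<Rightarrow> 'm"

type_synonym ('v, 'a, 'k, 'm) repr = "('k, ('v, 'a, 'k) free_alg set, 'm) algebra_action"

definition linear_between ::
  "('k \<Rightarrow> 'm \<Rightarrow> 'm) \<Rightarrow> 'm::ab_group_add set \<Rightarrow> ('k \<Rightarrow> 'n \<Rightarrow> 'n) \<Rightarrow> 'n::ab_group_add set
     \<Rightarrow> ('m \<Rightarrow> 'n) \<Rightarrow> bool" where
  "linear_between s V s' W f \<longleftrightarrow>
     f \<in> V \<rightarrow> W \<and>
     (\<forall>x\<in>V. \<forall>y\<in>V. f (x + y) = f x + f y) \<and>
     (\<forall>c. \<forall>x\<in>V. f (s c x) = s' c (f x))"

definition End_algebra ::
  "('k \<Rightarrow> 'm \<Rightarrow> 'm) \<Rightarrow> 'm::ab_group_add set \<Rightarrow> ('k, 'm \<Rightarrow> 'm) algebra" where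
  "End_algebra s V =
     \<lparr>acarrier = {f \<in> extensional V. linear_between s V s V f},
      aadd = \<lambda>f g. restrict (\<lambda>x. f x + g x) V,
      amult = \<lambda>f g. compose V f g,
      ascale = \<lambda>c f. restrict (\<lambda>x. s c (f x)) V\<rparr>"

definition is_representation ::
  "('v, 'a) pre_digraph \<Rightarrow> ('v, 'a, 'k::field, 'm::ab_group_add) repr \<Rightarrow> bool" where
  "is_representation Q M \<longleftrightarrow>
     vector_space (vscale M) \<and>
     module.subspace (vscale M) (vspace M) \<and>
     algebra_hom (leavitt_path_algebra Q) (End_algebra (vscale M) (vspace M)) (act M)"

definition rep_iso ::
  "('v, 'a) pre_digraph \<Rightarrow> ('v, 'a, 'k::field, 'm::ab_group_add) repr
     \<Rightarrow> ('v, 'a, 'k, 'n::ab_group_add) repr \<Rightarrow> ('m \<Rightarrow> 'n) \<Rightarrow> bool" where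
  "rep_iso Q M N f \<longleftrightarrow>
     linear_between (vscale M) (vspace M) (vscale N) (vspace N) f \<and>
     bij_betw f (vspace M) (vspace N) \<and>
     (\<forall>x\<in>acarrier (leavitt_path_algebra Q). \<forall>m\<in>vspace M. f (act M x m) = act N x (f m))"

definition isomorphic_reps ::
  "('v, 'a) pre_digraph \<Rightarrow> ('v, 'a, 'k::field, 'm::ab_group_add) repr
     \<Rightarrow> ('v, 'a, 'k, 'n::ab_group_add) repr \<Rightarrow> bool" where
  "isomorphic_reps Q M N \<longleftrightarrow>
     is_representation Q M \<and> is_representation Q N \<and> (\<exists>f. rep_iso Q M N f)"

definition subrep ::
  "('v, 'a, 'k, 'm) repr \<Rightarrow> 'm set \<Rightarrow> ('v, 'a, 'k, 'm) repr" where
  "subrep M W = M\<lparr>vspace := W, act := \<lambda>x. restrict (act M x) W\<rparr>"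

subsection \<open>Representations given on a basis\<close>

definition chi :: "'x \<Rightarrow> 'x \<Rightarrow>\<^sub>0 'k::field" where
  "chi x = Poly_Mapping.single x 1"

definition lin_ext :: "('x \<Rightarrow> 'y \<Rightarrow>\<^sub>0 'k) \<Rightarrow> ('x \<Rightarrow>\<^sub>0 'k::field) \<Rightarrow> ('y \<Rightarrow>\<^sub>0 'k)" where
  "lin_ext \<phi> f = (\<Sum>x\<in>Poly_Mapping.keys f. fscale (Poly_Mapping.lookup f x) (\<phi> x))"

definition free_act ::
  "(('v, 'a) gen \<Rightarrow> 'x \<Rightarrow> 'x \<Rightarrow>\<^sub>0 'k) \<Rightarrow> ('v, 'a, 'k::field) free_alg
     \<Rightarrow> ('x \<Rightarrow>\<^sub>0 'k) \<Rightarrow> ('x \<Rightarrow>\<^sub>0 'k)" where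
  "free_act \<phi> a f =
     (\<Sum>w\<in>Poly_Mapping.keys a. fscale (Poly_Mapping.lookup a w)
        (foldr (\<lambda>g. lin_ext (\<phi> g)) (letters w) f))"

text \<open>
  The vector space with basis \<open>X\<close>, where \<open>\<phi> g x\<close> is the result of letting the generator \<open>g\<close> act on
  the basis element \<open>x\<close>. The action of the Leavitt path algebra is well defined only if \<open>\<phi>\<close> respects
  the defining relations; \<^const>\<open>the_elem\<close> picks the common value on all representatives.
\<close>

definition basis_rep ::
  "'x set \<Rightarrow> (('v, 'a) gen \<Rightarrow> 'x \<Rightarrow> 'x \<Rightarrow>\<^sub>0 'k) \<Rightarrow> ('v, 'a, 'k::field, 'x \<Rightarrow>\<^sub>0 'k) repr" where
  "basis_rep X \<phi> =
     \<lparr>vscale = fscale,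
      vspace = {f. Poly_Mapping.keys f \<subseteq> X},
      act = \<lambda>C. the_elem ((\<lambda>a. restrict (free_act \<phi> a) {f. Poly_Mapping.keys f \<subseteq> X}) ` C)\<rparr>"


section \<open>The representations on infinite paths and on finite paths\<close>

fun F_gen ::
  "('v, 'a) pre_digraph \<Rightarrow> ('v, 'a) gen \<Rightarrow> 'a stream \<Rightarrow> 'a stream \<Rightarrow>\<^sub>0 'k::field" where
  "F_gen Q (Vert i) p = (if i = tail Q (shd p) then chi p else 0)"
| "F_gen Q (Arr \<alpha>) p = (if \<alpha> = shd p then chi (sdrop 1 p) else 0)"
| "F_gen Q (Ghost \<alpha>) p = (if head Q \<alpha> = tail Q (shd p) then chi (\<alpha> ## p) else 0)"

definition F_rep :: "('v, 'a) pre_digraph \<Rightarrow> ('v, 'a, 'k::field, 'a stream \<Rightarrow>\<^sub>0 'k) repr" where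
  "F_rep Q = basis_rep (left_infinite_paths Q) (F_gen Q)"

definition F_class ::
  "('v, 'a) pre_digraph \<Rightarrow> 'a stream \<Rightarrow> ('v, 'a, 'k::field, 'a stream \<Rightarrow>\<^sub>0 'k) repr" where
  "F_class Q p = subrep (F_rep Q) (module.span fscale (chi ` tail_class Q p))"

definition sink_paths :: "('v, 'a) pre_digraph \<Rightarrow> ('v, 'a) fpath set" where
  "sink_paths Q = (\<Union>i\<in>{i. is_sink Q i}. finite_paths_to Q i)"

fun N_gen ::
  "('v, 'a) pre_digraph \<Rightarrow> ('v, 'a) gen \<Rightarrow> ('v, 'a) fpath \<Rightarrow> ('v, 'a) fpath \<Rightarrow>\<^sub>0 'k::field" where
  "N_gen Q (Vert i) (v, as) = (if i = v then chi (v, as) else 0)"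
| "N_gen Q (Arr \<alpha>) (v, []) = 0"
| "N_gen Q (Arr \<alpha>) (v, \<beta> # as) = (if \<alpha> = \<beta> then chi (head Q \<beta>, as) else 0)"
| "N_gen Q (Ghost \<alpha>) (v, as) = (if head Q \<alpha> = v then chi (tail Q \<alpha>, \<alpha> # as) else 0)"

definition N_rep ::
  "('v, 'a) pre_digraph \<Rightarrow> ('v, 'a, 'k::field, ('v, 'a) fpath \<Rightarrow>\<^sub>0 'k) repr" where
  "N_rep Q = basis_rep (sink_paths Q) (N_gen Q)"

definition N_at ::
  "('v, 'a) pre_digraph \<Rightarrow> 'v \<Rightarrow> ('v, 'a, 'k::field, ('v, 'a) fpath \<Rightarrow>\<^sub>0 'k) repr" where
  "N_at Q i = subrep (N_rep Q) (module.span fscale (chi ` (sink_paths Q \<inter> finite_paths_to Q i)))"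


section \<open>Algebraic branching systems\<close>

record ('v, 'a, 'x) branching =
  bset :: "'x set"
  bvert :: "'v \<Rightarrow> 'x set"
  barr :: "'a \<Rightarrow> 'x set"
  bmap :: "'a \<Rightarrow> 'x \<Rightarrow> 'x"

definition algebraic_branching_system ::
  "('v, 'a) pre_digraph \<Rightarrow> ('v, 'a, 'x) branching \<Rightarrow> bool" where
  "algebraic_branching_system Q X \<longleftrightarrow>
     (\<forall>i\<in>verts Q. bvert X i \<subseteq> bset X) \<and>
     (\<forall>\<alpha>\<in>arcs Q. barr X \<alpha> \<subseteq> bset X) \<and>
     (\<forall>\<alpha>\<in>arcs Q. bij_betw (bmap X \<alpha>) (bvert X (head Q \<alpha>)) (barr X \<alpha>)) \<and>
     (\<forall>i\<in>verts Q. \<forall>j\<in>verts Q. i \<noteq> j \<longrightarrow> bvert X i \<inter> bvert X j = {}) \<and>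
     (\<forall>\<alpha>\<in>arcs Q. \<forall>\<beta>\<in>arcs Q. \<alpha> \<noteq> \<beta> \<longrightarrow> barr X \<alpha> \<inter> barr X \<beta> = {}) \<and>
     (\<forall>\<alpha>\<in>arcs Q. barr X \<alpha> \<subseteq> bvert X (tail Q \<alpha>)) \<and>
     (\<forall>i. regular Q i \<longrightarrow> bvert X i = (\<Union>\<alpha>\<in>out_arcs Q i. barr X \<alpha>))"

fun M_gen ::
  "('v, 'a) pre_digraph \<Rightarrow> ('v, 'a, 'x) branching \<Rightarrow> ('v, 'a) gen \<Rightarrow> 'x \<Rightarrow> 'x \<Rightarrow>\<^sub>0 'k::field" where
  "M_gen Q X (Vert i) x = (if x \<in> bvert X i then chi x else 0)"
| "M_gen Q X (Arr \<alpha>) x =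
     (if x \<in> barr X \<alpha> then chi (inv_into (bvert X (head Q \<alpha>)) (bmap X \<alpha>) x) else 0)"
| "M_gen Q X (Ghost \<alpha>) x = (if x \<in> bvert X (head Q \<alpha>) then chi (bmap X \<alpha> x) else 0)"

definition M_rep ::
  "('v, 'a) pre_digraph \<Rightarrow> ('v, 'a, 'x) branching \<Rightarrow> ('v, 'a, 'k::field, 'x \<Rightarrow>\<^sub>0 'k) repr" where
  "M_rep Q X = basis_rep (bset X) (M_gen Q X)"

definition class_branching ::
  "('v, 'a) pre_digraph \<Rightarrow> 'a stream \<Rightarrow> ('v, 'a, 'a stream) branching" where
  "class_branching Q p =
     \<lparr>bset = tail_class Q p,
      bvert = \<lambda>i. {q \<in> tail_class Q p. tail Q (shd q) = i},
      barr = \<lambda>\<alpha>. {q \<in> tail_class Q p. shd q = \<alpha>},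
      bmap = \<lambda>\<alpha> q. \<alpha> ## q\<rparr>"

definition sink_branching ::
  "('v, 'a) pre_digraph \<Rightarrow> 'v \<Rightarrow> ('v, 'a, ('v, 'a) fpath) branching" where
  "sink_branching Q i =
     \<lparr>bset = finite_paths_to Q i,
      bvert = \<lambda>j. {q \<in> finite_paths_to Q i. fst q = j},
      barr = \<lambda>\<alpha>. {q \<in> finite_paths_to Q i. snd q \<noteq> [] \<and> hd (snd q) = \<alpha>},
      bmap = \<lambda>\<alpha> q. (tail Q \<alpha>, \<alpha> # snd q)\<rparr>"

lemma left_infinite_paths_Cons:
  "\<alpha> ## q \<in> left_infinite_paths Q \<longleftrightarrow>
     \<alpha> \<in> arcs Q \<and> head Q \<alpha> = tail Q (shd q) \<and> q \<in> left_infinite_paths Q"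
proof
  assume L: "\<alpha> ## q \<in> left_infinite_paths Q"
  have "(\<alpha> ## q) !! n \<in> arcs Q \<and> head Q ((\<alpha> ## q) !! n) = tail Q ((\<alpha> ## q) !! Suc n)" for n
    using L by (simp add: left_infinite_paths_def)
  from this[of 0] this[of "Suc n" for n]
  show "\<alpha> \<in> arcs Q \<and> head Q \<alpha> = tail Q (shd q) \<and> q \<in> left_infinite_paths Q"
    by (auto simp: left_infinite_paths_def)
next
  assume R: "\<alpha> \<in> arcs Q \<and> head Q \<alpha> = tail Q (shd q) \<and> q \<in> left_infinite_paths Q"
  have "(\<alpha> ## q) !! n \<in> arcs Q \<and> head Q ((\<alpha> ## q) !! n) = tail Q ((\<alpha> ## q) !! Suc n)" for n
    using R by (cases n) (auto simp: left_infinite_paths_def)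
  then show "\<alpha> ## q \<in> left_infinite_paths Q"
    by (simp add: left_infinite_paths_def)
qed

lemma tail_equivalent_Cons: "tail_equivalent p (\<alpha> ## q) \<longleftrightarrow> tail_equivalent p q"
proof
  assume "tail_equivalent p (\<alpha> ## q)"
  then obtain n m where nm: "sdrop n p = sdrop m (\<alpha> ## q)"
    by (auto simp: tail_equivalent_def)
  have "sdrop (Suc n) p = sdrop m q"
    using arg_cong[OF nm, of stl] by (metis sdrop_simps(2) sdrop.simps(2) stream.sel(2))
  then show "tail_equivalent p q"
    unfolding tail_equivalent_def by blast
next
  assume "tail_equivalent p q"
  then obtain n m where "sdrop n p = sdrop (Suc m) (\<alpha> ## q)"
    by (auto simp: tail_equivalent_def)
  then show "tail_equivalent p (\<alpha> ## q)"
    unfolding tail_equivalent_def by blast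
qed

lemma tail_class_Cons:
  "\<alpha> ## q \<in> tail_class Q p \<longleftrightarrow> \<alpha> \<in> arcs Q \<and> head Q \<alpha> = tail Q (shd q) \<and> q \<in> tail_class Q p"
  by (auto simp: tail_class_def left_infinite_paths_Cons tail_equivalent_Cons)

lemma class_branching_system:
  assumes "wf_digraph Q"
  shows "algebraic_branching_system Q (class_branching Q p)"
proof -
  have arc: "shd q \<in> arcs Q" if "q \<in> tail_class Q p" for q
    using that tail_class_Cons[of "shd q" "stl q" Q p] by simp
  have "bij_betw ((##) \<alpha>) {q \<in> tail_class Q p. tail Q (shd q) = head Q \<alpha>}
      {q \<in> tail_class Q p. shd q = \<alpha>}" if "\<alpha> \<in> arcs Q" for \<alpha>
  proof (rule bij_betwI[where g = stl])
    show "stl \<in> {q \<in> tail_class Q p. shd q = \<alpha>}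
        \<rightarrow> {q \<in> tail_class Q p. tail Q (shd q) = head Q \<alpha>}"
    proof
      fix q assume q: "q \<in> {q \<in> tail_class Q p. shd q = \<alpha>}"
      then show "stl q \<in> {q \<in> tail_class Q p. tail Q (shd q) = head Q \<alpha>}"
        using tail_class_Cons[of "shd q" "stl q" Q p] by auto
    qed
  qed (use that in \<open>auto simp: tail_class_Cons\<close>)
  with arc show ?thesis
    by (auto simp: algebraic_branching_system_def class_branching_def)
qed

lemma finite_paths_to_Cons:
  assumes "wf_digraph Q"
  shows "(v, \<alpha> # as) \<in> finite_paths_to Q i \<longleftrightarrow>
    \<alpha> \<in> arcs Q \<and> v = tail Q \<alpha> \<and> (head Q \<alpha>, as) \<in> finite_paths_to Q i"
  by (simp add: finite_paths_to_def wf_digraph.awalk_Cons_iff[OF assms])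

lemma sink_branching_system:
  assumes "wf_digraph Q" "is_sink Q i"
  shows "algebraic_branching_system Q (sink_branching Q i)"
proof -
  note [simp] = finite_paths_to_Cons[OF assms(1)]
  have arc: "\<exists>\<alpha> as. q = (tail Q \<alpha>, \<alpha> # as) \<and> \<alpha> \<in> arcs Q \<and> (head Q \<alpha>, as) \<in> finite_paths_to Q i"
    if "q \<in> finite_paths_to Q i" "snd q \<noteq> []" for q
    using that by (cases q; cases "snd q") auto
  have triv: "fst q = i" if "q \<in> finite_paths_to Q i" "snd q = []" for q
    using that by (cases q) (simp add: finite_paths_to_def pre_digraph.awalk_def pre_digraph.cas.simps)
  have "bij_betw (\<lambda>q. (tail Q \<alpha>, \<alpha> # snd q)) {q \<in> finite_paths_to Q i. fst q = head Q \<alpha>}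
      {q \<in> finite_paths_to Q i. snd q \<noteq> [] \<and> hd (snd q) = \<alpha>}" if "\<alpha> \<in> arcs Q" for \<alpha>
  proof (rule bij_betwI[where g = "\<lambda>q. (head Q \<alpha>, tl (snd q))"])
    show "(\<lambda>q. (head Q \<alpha>, tl (snd q))) \<in> {q \<in> finite_paths_to Q i. snd q \<noteq> [] \<and> hd (snd q) = \<alpha>}
        \<rightarrow> {q \<in> finite_paths_to Q i. fst q = head Q \<alpha>}"
    proof
      fix q assume "q \<in> {q \<in> finite_paths_to Q i. snd q \<noteq> [] \<and> hd (snd q) = \<alpha>}"
      with arc[of q] show "(head Q \<alpha>, tl (snd q)) \<in> {q \<in> finite_paths_to Q i. fst q = head Q \<alpha>}"
        by auto
    qed
    show "(tail Q \<alpha>, \<alpha> # snd (head Q \<alpha>, tl (snd q))) = q"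
      if "q \<in> {q \<in> finite_paths_to Q i. snd q \<noteq> [] \<and> hd (snd q) = \<alpha>}" for q
      using that arc[of q] by auto
  qed (use that in auto)
  moreover have "snd q \<noteq> [] \<and> hd (snd q) \<in> out_arcs Q j"
    if "regular Q j" "q \<in> finite_paths_to Q i" "fst q = j" for j q
  proof -
    have "snd q \<noteq> []"
      using that triv[of q] assms(2) unfolding regular_def by metis
    then show ?thesis
      using arc[OF that(2)] that(3) by auto
  qed
  moreover have "fst q = tail Q (hd (snd q))" if "q \<in> finite_paths_to Q i" "snd q \<noteq> []" for q
    using arc[OF that] by auto
  ultimately show ?thesis
    by (fastforce simp: algebraic_branching_system_def sink_branching_def)
qed

end

theory Submission
  imports Defs
begin

section \<open>Linear extension\<close>

text \<open>Both isomorphisms are the identity map. By \<open>span_chi\<close>,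
  \<open>F_class Q p\<close> lives on the finitely supported functions on the tail class of
  \<open>p\<close>, which is also the space of the associated branching representation. The
  generators act on its basis by the same formulas: adding a first arrow is the map \<sigma> of the
  branching system, removing it is the inverse (\<open>F_gen_eq_M_gen\<close>). The same holds for
  paths ending at a sink (\<open>N_gen_eq_M_gen\<close>).

  What takes work is that these formulas define representations at all. A class in the quotient
  algebra acts through its representatives, so every relator has to act by zero.
  \<open>leavitt_compatible_M_gen\<close> checks this on the basis of an arbitrary branching system,
  and \<open>free_act_leavitt_ideal\<close> extends it to the whole ideal and to all vectors.

  The large representations on all left-infinite paths and on all paths to sinks need no second
  check. Compatibility is a condition on one basis vector at a time, and their bases are unions of
  branching systems on which the actions agree (\<open>leavitt_compatible_local\<close>).
  \<open>isomorphic_reps_covered\<close> carries this out for any basis so covered; the theorem is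
  two instances of it.\<close>

lemma lookup_fscale [simp]: "Poly_Mapping.lookup (fscale c f) x = c * Poly_Mapping.lookup f x"
  by (simp add: fscale_def map.rep_eq when_def)

interpretation fscale: vector_space "fscale :: 'k::field \<Rightarrow> ('x \<Rightarrow>\<^sub>0 'k) \<Rightarrow> ('x \<Rightarrow>\<^sub>0 'k)"
  by standard (auto intro!: poly_mapping_eqI simp: lookup_add algebra_simps)

lemma keys_fscale_subset: "Poly_Mapping.keys (fscale c f) \<subseteq> Poly_Mapping.keys f"
  by (auto simp: in_keys_iff)

lemma keys_chi [simp]: "Poly_Mapping.keys (chi x :: 'x \<Rightarrow>\<^sub>0 'k::field) = {x}"
  by (simp add: chi_def)

abbreviation supported_on :: "'x set \<Rightarrow> ('x \<Rightarrow>\<^sub>0 'k::field) set" where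
  "supported_on X \<equiv> {f. Poly_Mapping.keys f \<subseteq> X}"

lemma subspace_supported_on: "fscale.subspace (supported_on X)"
  using keys_add keys_fscale_subset by (fastforce simp: fscale.subspace_def)

lemma lin_ext_superset:
  assumes "finite S" "Poly_Mapping.keys f \<subseteq> S"
  shows "lin_ext \<phi> f = (\<Sum>x\<in>S. fscale (Poly_Mapping.lookup f x) (\<phi> x))"
  unfolding lin_ext_def
  using assms by (intro sum.mono_neutral_left) (auto simp: in_keys_iff)

lemma lin_ext_single [simp]: "lin_ext \<phi> (Poly_Mapping.single x c) = fscale c (\<phi> x)"
  by (simp add: lin_ext_superset[of "{x}"] lookup_single)

lemma lin_ext_chi [simp]: "lin_ext \<phi> (chi x) = \<phi> x"
  by (simp add: chi_def)

lemma module_hom_lin_ext: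
  fixes \<phi> :: "'x \<Rightarrow> 'y \<Rightarrow>\<^sub>0 'k::field"
  shows "module_hom fscale fscale (lin_ext \<phi>)"
proof
  fix f g :: "'x \<Rightarrow>\<^sub>0 'k" and c
  \<comment> \<open>The support of \<open>f + g\<close> may shrink by cancellation, so all three
    sums are taken over one common finite set.\<close>
  let ?S = "Poly_Mapping.keys f \<union> Poly_Mapping.keys g"
  have "lin_ext \<phi> (f + g) = (\<Sum>x\<in>?S. fscale (Poly_Mapping.lookup (f + g) x) (\<phi> x))"
    using keys_add[of f g] by (intro lin_ext_superset) auto
  also have "\<dots> = lin_ext \<phi> f + lin_ext \<phi> g"
    by (simp add: lin_ext_superset[of ?S] lookup_add fscale.scale_left_distrib sum.distrib)
  finally show "lin_ext \<phi> (f + g) = lin_ext \<phi> f + lin_ext \<phi> g" .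
  show "lin_ext \<phi> (fscale c f) = fscale c (lin_ext \<phi> f)"
    by (simp add: lin_ext_superset[OF finite_keys keys_fscale_subset] lin_ext_def[of _ f]
        fscale.scale_sum_right)
qed

lemmas lin_ext_simps [simp] =
  module_hom.zero[OF module_hom_lin_ext] module_hom.add[OF module_hom_lin_ext]
  module_hom.diff[OF module_hom_lin_ext] module_hom.scale[OF module_hom_lin_ext]
  module_hom.sum[OF module_hom_lin_ext]

lemma sum_single_lookup:
  "(\<Sum>x\<in>Poly_Mapping.keys f. Poly_Mapping.single x (Poly_Mapping.lookup f x)) = f"
  by (rule poly_mapping_eqI) (simp add: lookup_sum lookup_single when_def in_keys_iff)

lemma fscale_chi: "fscale c (chi x) = Poly_Mapping.single x c"
  by (rule poly_mapping_eqI) (simp add: chi_def lookup_single when_def)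

lemma lin_ext_chi_eq: "lin_ext chi f = f"
  by (simp add: lin_ext_def fscale_chi sum_single_lookup)

lemma poly_mapping_induct_add [case_names zero single add]:
  fixes f :: "'x \<Rightarrow>\<^sub>0 'k::comm_monoid_add"
  assumes "P 0" "\<And>x c. P (Poly_Mapping.single x c)" "\<And>f g. P f \<Longrightarrow> P g \<Longrightarrow> P (f + g)"
  shows "P f"
proof -
  have "P (\<Sum>x\<in>S. Poly_Mapping.single x (Poly_Mapping.lookup f x))" if "finite S" for S
    using that by induction (auto intro: assms)
  then show ?thesis
    using sum_single_lookup[of f] by (metis finite_keys)
qed

lemma lin_ext_fun_add: "lin_ext (\<lambda>x. \<phi> x + \<psi> x) f = lin_ext \<phi> f + lin_ext \<psi> f"
  by (simp add: lin_ext_def fscale.scale_right_distrib sum.distrib)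

lemma lin_ext_fun_scale: "lin_ext (\<lambda>x. fscale c (\<phi> x)) f = fscale c (lin_ext \<phi> f)"
  by (simp add: lin_ext_def fscale.scale_sum_right mult.commute)

lemma lin_ext_compose:
  assumes "module_hom fscale fscale h"
  shows "h (lin_ext \<phi> f) = lin_ext (\<lambda>x. h (\<phi> x)) f"
  by (simp add: lin_ext_def module_hom.sum[OF assms] module_hom.scale[OF assms])

lemma lin_ext_cong:
  assumes "\<And>x. x \<in> Poly_Mapping.keys f \<Longrightarrow> \<phi> x = \<psi> x"
  shows "lin_ext \<phi> f = lin_ext \<psi> f"
  using assms by (simp add: lin_ext_def)

lemma lin_ext_in_supported_on:
  assumes "\<And>x. x \<in> Poly_Mapping.keys f \<Longrightarrow> \<phi> x \<in> supported_on Y"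
  shows "lin_ext \<phi> f \<in> supported_on Y"
  unfolding lin_ext_def
  by (intro fscale.subspace_sum[OF subspace_supported_on] fscale.subspace_scale[OF subspace_supported_on] assms)

text \<open>Subrepresentations are given as spans of basis vectors, \<open>basis_rep\<close> by a
  condition on supports; this identifies the two kinds of space.\<close>

lemma span_chi: "fscale.span (chi ` X) = (supported_on X :: ('x \<Rightarrow>\<^sub>0 'k::field) set)"
proof
  show "fscale.span (chi ` X) \<subseteq> (supported_on X :: ('x \<Rightarrow>\<^sub>0 'k) set)"
    by (rule fscale.span_minimal[OF _ subspace_supported_on]) auto
  show "supported_on X \<subseteq> (fscale.span (chi ` X) :: ('x \<Rightarrow>\<^sub>0 'k) set)"
  proof
    fix f :: "'x \<Rightarrow>\<^sub>0 'k" assume f: "f \<in> supported_on X"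
    have "Poly_Mapping.single x c \<in> fscale.span (chi ` X)" if "x \<in> X" for x and c :: 'k
      using that by (simp add: fscale_chi[symmetric] fscale.span_scale fscale.span_base)
    then have "(\<Sum>x\<in>Poly_Mapping.keys f. Poly_Mapping.single x (Poly_Mapping.lookup f x))
        \<in> fscale.span (chi ` X)"
      using f by (intro fscale.span_sum) auto
    then show "f \<in> fscale.span (chi ` X)"
      by (simp add: sum_single_lookup)
  qed
qed

section \<open>The action of the free algebra\<close>

abbreviation word_act ::
  "(('v, 'a) gen \<Rightarrow> 'x \<Rightarrow> 'x \<Rightarrow>\<^sub>0 'k::field) \<Rightarrow> ('v, 'a) gen list \<Rightarrow> ('x \<Rightarrow>\<^sub>0 'k) \<Rightarrow> ('x \<Rightarrow>\<^sub>0 'k)" where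
  "word_act \<phi> \<equiv> foldr (\<lambda>g. lin_ext (\<phi> g))"

text \<open>With the vector \<open>f\<close> fixed, the action is a linear extension in the algebra
  element, so linearity in that argument comes from the lemmas on \<open>lin_ext\<close>.\<close>

lemma free_act_eq_lin_ext: "free_act \<phi> a f = lin_ext (\<lambda>w. word_act \<phi> (letters w) f) a"
  by (simp add: free_act_def lin_ext_def)

lemma module_hom_word_act: "module_hom fscale fscale (word_act \<phi> gs)"
proof (induction gs)
  case Nil
  show ?case
    by (simp add: module_hom_iff fscale.module_axioms)
next
  case (Cons g gs)
  then show ?case
    using module_hom_compose[OF Cons module_hom_lin_ext] by (simp add: comp_def)
qed

lemma module_hom_free_act: "module_hom fscale fscale (free_act \<phi> a)"
proof
  show "free_act \<phi> a (f + g) = free_act \<phi> a f + free_act \<phi> a g" for f g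
    by (simp add: free_act_eq_lin_ext module_hom.add[OF module_hom_word_act] lin_ext_fun_add)
  show "free_act \<phi> a (fscale c f) = fscale c (free_act \<phi> a f)" for c f
    by (simp add: free_act_eq_lin_ext module_hom.scale[OF module_hom_word_act] lin_ext_fun_scale)
qed

lemma free_act_add: "free_act \<phi> (a + b) f = free_act \<phi> a f + free_act \<phi> b f"
  and free_act_diff: "free_act \<phi> (a - b) f = free_act \<phi> a f - free_act \<phi> b f"
  and free_act_scale: "free_act \<phi> (fscale c a) f = fscale c (free_act \<phi> a f)"
  and free_act_zero: "free_act \<phi> 0 f = 0"
  and free_act_sum: "free_act \<phi> (\<Sum>i\<in>I. r i) f = (\<Sum>i\<in>I. free_act \<phi> (r i) f)"
  and free_act_mon: "free_act \<phi> (mon gs) f = word_act \<phi> gs f"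
  by (simp_all add: free_act_eq_lin_ext mon_def)

text \<open>Both sides are bilinear in \<open>a\<close> and \<open>b\<close>, which leaves scalar
  multiples of words. For words, \<open>foldr\<close> lets the last letter act first, so
  concatenation acts as composition.\<close>

lemma free_act_mult: "free_act \<phi> (a * b) f = free_act \<phi> a (free_act \<phi> b f)"
proof (induction a rule: poly_mapping_induct_add)
  case (single u c)
  show ?case
  proof (induction b rule: poly_mapping_induct_add)
    case (single v d)
    then show ?case
      by (simp add: mult_single free_act_eq_lin_ext plus_free_monoid_def
          module_hom.scale[OF module_hom_word_act])
  qed (simp_all add: distrib_left free_act_add free_act_zero
      module_hom.add[OF module_hom_free_act] module_hom.zero[OF module_hom_free_act])
qed (simp_all add: distrib_right free_act_add free_act_zero)

section \<open>Invariance and locality of the action on supports\<close>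

lemma word_act_in_supported_on:
  assumes "\<And>g x. g \<in> set gs \<Longrightarrow> x \<in> X \<Longrightarrow> \<phi> g x \<in> supported_on X" "f \<in> supported_on X"
  shows "word_act \<phi> gs f \<in> supported_on X"
  using assms(1)
proof (induction gs)
  case (Cons g gs)
  then have "word_act \<phi> gs f \<in> supported_on X"
    by simp
  then show ?case
    using Cons.prems by (auto intro!: lin_ext_in_supported_on[unfolded mem_Collect_eq])
qed (use assms(2) in simp)

text \<open>The two generator actions agree only on basis elements in \<open>X\<close>; closure of
  \<open>X\<close> keeps every intermediate vector where they can be compared.\<close>

lemma word_act_cong:
  assumes "\<And>g x. g \<in> set gs \<Longrightarrow> x \<in> X \<Longrightarrow> \<phi> g x \<in> supported_on X" "f \<in> supported_on X"
    and "\<And>g x. g \<in> set gs \<Longrightarrow> x \<in> X \<Longrightarrow> \<phi> g x = \<psi> g x"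
  shows "word_act \<phi> gs f = word_act \<psi> gs f"
  using assms(1,3)
proof (induction gs)
  case (Cons g gs)
  have "word_act \<phi> gs f \<in> supported_on X"
    using Cons.prems(1) assms(2) by (intro word_act_in_supported_on) auto
  then have "lin_ext (\<phi> g) (word_act \<phi> gs f) = lin_ext (\<psi> g) (word_act \<phi> gs f)"
    using Cons.prems(2) by (intro lin_ext_cong) auto
  with Cons show ?case
    by simp
qed simp

section \<open>The quotient algebra\<close>

lemma free_carrier_zero: "0 \<in> free_carrier Q"
  by (simp add: free_carrier_def)

lemma free_carrier_add: "a \<in> free_carrier Q \<Longrightarrow> b \<in> free_carrier Q \<Longrightarrow> a + b \<in> free_carrier Q"
  using keys_add[of a b] by (auto simp: free_carrier_def)

lemma free_carrier_scale: "a \<in> free_carrier Q \<Longrightarrow> fscale c a \<in> free_carrier Q"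
  using keys_fscale_subset[of c a] by (auto simp: free_carrier_def)

lemma free_carrier_diff: "a \<in> free_carrier Q \<Longrightarrow> b \<in> free_carrier Q \<Longrightarrow> a - b \<in> free_carrier Q"
  using free_carrier_add[OF _ free_carrier_scale[of b Q "-1"], of a] by simp

lemma free_carrier_sum: "(\<And>i. i \<in> I \<Longrightarrow> r i \<in> free_carrier Q) \<Longrightarrow> (\<Sum>i\<in>I. r i) \<in> free_carrier Q"
  by (induction I rule: infinite_finite_induct) (auto intro: free_carrier_zero free_carrier_add)

lemma free_carrier_mult: "a \<in> free_carrier Q \<Longrightarrow> b \<in> free_carrier Q \<Longrightarrow> a * b \<in> free_carrier Q"
  using keys_mult[of a b] by (fastforce simp: free_carrier_def plus_free_monoid_def)

lemma free_carrier_mon: "gs \<noteq> [] \<Longrightarrow> set gs \<subseteq> gens Q \<Longrightarrow> mon gs \<in> free_carrier Q"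
  by (simp add: free_carrier_def mon_def)

lemma relators_in_free_carrier:
  assumes "wf_digraph Q" "r \<in> relators Q"
  shows "r \<in> free_carrier Q"
  using assms(2)
  by cases (auto intro!: free_carrier_diff free_carrier_mon free_carrier_zero free_carrier_sum
      simp: gens_def regular_def wf_digraph.head_in_verts[OF assms(1)]
        wf_digraph.tail_in_verts[OF assms(1)])

lemma equiv_leavitt_rel: "equiv (free_carrier Q) (leavitt_rel Q)"
proof (rule equivI)
  show "refl_on (free_carrier Q) (leavitt_rel Q)"
    by (auto simp: refl_on_def leavitt_rel_def ideal_zero)
  show "sym (leavitt_rel Q)"
    \<comment> \<open>Scaling by -1 turns \<open>a - b\<close> into \<open>b - a\<close>.\<close>
    using ideal_scale[where c = "-1"] by (fastforce simp: sym_def leavitt_rel_def)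
  show "trans (leavitt_rel Q)"
  proof (rule transI)
    show "(a, c) \<in> leavitt_rel Q" if "(a, b) \<in> leavitt_rel Q" "(b, c) \<in> leavitt_rel Q" for a b c
      using that ideal_add[of "a - b" Q "b - c"] by (simp add: leavitt_rel_def)
  qed
qed (auto simp: leavitt_rel_def)

abbreviation leavitt_class ::
  "('v, 'a) pre_digraph \<Rightarrow> ('v, 'a, 'k::field) free_alg \<Rightarrow> ('v, 'a, 'k) free_alg set" where
  "leavitt_class Q a \<equiv> leavitt_rel Q `` {a}"

section \<open>Operations on classes computed on representatives\<close>

lemma leavitt_class_add:
  fixes a b :: "('v, 'a, 'k::field) free_alg"
  assumes "a \<in> free_carrier Q" "b \<in> free_carrier Q"
  shows "aadd (leavitt_path_algebra Q) (leavitt_class Q a) (leavitt_class Q b) = leavitt_class Q (a + b)"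
proof -
  have "(\<lambda>(a :: ('v, 'a, 'k) free_alg) b. leavitt_class Q (a + b)) respects2 leavitt_rel Q"
  proof (rule congruent2I', rule equiv_class_eq[OF equiv_leavitt_rel])
    fix a a' b b' :: "('v, 'a, 'k) free_alg"
    assume "(a, a') \<in> leavitt_rel Q" "(b, b') \<in> leavitt_rel Q"
    then show "(a + b, a' + b') \<in> leavitt_rel Q"
      using ideal_add[of "a - a'" Q "b - b'"]
      by (auto simp: leavitt_rel_def free_carrier_add algebra_simps)
  qed
  from UN_equiv_class2[OF equiv_leavitt_rel equiv_leavitt_rel this assms] show ?thesis
    by (simp add: leavitt_path_algebra_def)
qed

lemma leavitt_class_mult:
  fixes a b :: "('v, 'a, 'k::field) free_alg"
  assumes "a \<in> free_carrier Q" "b \<in> free_carrier Q"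
  shows "amult (leavitt_path_algebra Q) (leavitt_class Q a) (leavitt_class Q b) = leavitt_class Q (a * b)"
proof -
  have "(\<lambda>(a :: ('v, 'a, 'k) free_alg) b. leavitt_class Q (a * b)) respects2 leavitt_rel Q"
  proof (rule congruent2I', rule equiv_class_eq[OF equiv_leavitt_rel])
    fix a a' b b' :: "('v, 'a, 'k) free_alg"
    assume ab: "(a, a') \<in> leavitt_rel Q" "(b, b') \<in> leavitt_rel Q"
    \<comment> \<open>Each summand lies in the ideal because it is two-sided.\<close>
    have "a * b - a' * b' = a * (b - b') + (a - a') * b'"
      by (simp add: algebra_simps)
    with ab show "(a * b, a' * b') \<in> leavitt_rel Q"
      by (auto simp: leavitt_rel_def intro!: free_carrier_mult
          intro: ideal_add ideal_mult_left ideal_mult_right)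
  qed
  from UN_equiv_class2[OF equiv_leavitt_rel equiv_leavitt_rel this assms] show ?thesis
    by (simp add: leavitt_path_algebra_def)
qed

lemma leavitt_class_scale:
  fixes a :: "('v, 'a, 'k::field) free_alg"
  assumes "a \<in> free_carrier Q"
  shows "ascale (leavitt_path_algebra Q) c (leavitt_class Q a) = leavitt_class Q (fscale c a)"
proof -
  have "congruent (leavitt_rel Q) (\<lambda>a. leavitt_class Q (fscale c a))"
  proof (rule congruentI, rule equiv_class_eq[OF equiv_leavitt_rel])
    fix a a' :: "('v, 'a, 'k) free_alg"
    assume "(a, a') \<in> leavitt_rel Q"
    then show "(fscale c a, fscale c a') \<in> leavitt_rel Q"
      using ideal_scale[of "a - a'" Q c]
      by (auto simp: leavitt_rel_def free_carrier_scale fscale.scale_right_diff_distrib)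
  qed
  from UN_equiv_class[OF equiv_leavitt_rel this assms] show ?thesis
    by (simp add: leavitt_path_algebra_def)
qed

lemma ball_leavitt_path_algebra:
  "(\<forall>C\<in>acarrier (leavitt_path_algebra Q). P C) \<longleftrightarrow> (\<forall>a\<in>free_carrier Q. P (leavitt_class Q a))"
  by (auto simp: leavitt_path_algebra_def quotient_def)

section \<open>Actions respecting the Leavitt relations\<close>

text \<open>The condition for the action of the free algebra to descend to the quotient. Relations
  are tested on basis vectors only, which makes it checkable piece by piece.\<close>

definition leavitt_compatible ::
  "('v, 'a) pre_digraph \<Rightarrow> 'x set \<Rightarrow> (('v, 'a) gen \<Rightarrow> 'x \<Rightarrow> 'x \<Rightarrow>\<^sub>0 'k::field) \<Rightarrow> bool" where
  "leavitt_compatible Q X \<phi> \<longleftrightarrow>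
     (\<forall>g\<in>gens Q. \<forall>x\<in>X. \<phi> g x \<in> supported_on X) \<and>
     (\<forall>r\<in>relators Q. \<forall>x\<in>X. free_act \<phi> r (chi x) = 0)"

lemma free_act_in_supported_on:
  assumes "\<And>g x. g \<in> gens Q \<Longrightarrow> x \<in> X \<Longrightarrow> \<phi> g x \<in> supported_on X"
    and "a \<in> free_carrier Q" "f \<in> supported_on X"
  shows "free_act \<phi> a f \<in> supported_on X"
  unfolding free_act_eq_lin_ext
  using assms by (intro lin_ext_in_supported_on word_act_in_supported_on) (auto simp: free_carrier_def)

lemma free_act_cong:
  assumes "\<And>g x. g \<in> gens Q \<Longrightarrow> x \<in> X \<Longrightarrow> \<phi> g x \<in> supported_on X"
    and "\<And>g x. g \<in> gens Q \<Longrightarrow> x \<in> X \<Longrightarrow> \<phi> g x = \<psi> g x"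
    and "a \<in> free_carrier Q" "f \<in> supported_on X"
  shows "free_act \<phi> a f = free_act \<psi> a f"
  unfolding free_act_eq_lin_ext
proof (rule lin_ext_cong)
  fix w assume "w \<in> Poly_Mapping.keys a"
  then have "set (letters w) \<subseteq> gens Q"
    using assms(3) by (auto simp: free_carrier_def)
  then have "g \<in> gens Q" if "g \<in> set (letters w)" for g
    using that by blast
  then show "word_act \<phi> (letters w) f = word_act \<psi> (letters w) f"
    by (intro word_act_cong[where X = X] assms)
qed

text \<open>A relator applied to \<open>chi x\<close> never leaves the span of \<open>Y x\<close>,
  where the action is that of \<open>\<psi> x\<close>; hence it gives zero.\<close>

lemma leavitt_compatible_local:
  fixes \<phi> :: "('v, 'a) gen \<Rightarrow> 'x \<Rightarrow> 'x \<Rightarrow>\<^sub>0 'k::field"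
  assumes "wf_digraph Q"
    and "\<And>x. x \<in> X \<Longrightarrow> x \<in> Y x \<and> Y x \<subseteq> X \<and> leavitt_compatible Q (Y x) (\<psi> x)"
    and "\<And>x y g. x \<in> X \<Longrightarrow> g \<in> gens Q \<Longrightarrow> y \<in> Y x \<Longrightarrow> \<phi> g y = \<psi> x g y"
  shows "leavitt_compatible Q X \<phi>"
  unfolding leavitt_compatible_def
proof (intro conjI ballI)
  fix g x assume "g \<in> gens Q" "x \<in> X"
  then show "\<phi> g x \<in> supported_on X"
    using assms(2)[of x] assms(3)[of x g x] by (fastforce simp: leavitt_compatible_def)
next
  fix r :: "('v, 'a, 'k) free_alg" and x assume r: "r \<in> relators Q" and x: "x \<in> X"
  have "free_act (\<psi> x) r (chi x) = free_act \<phi> r (chi x)"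
    using assms(2)[OF x] assms(3)[OF x]
    by (intro free_act_cong[OF _ _ relators_in_free_carrier[OF assms(1) r], where X = "Y x"])
       (auto simp: leavitt_compatible_def)
  then show "free_act \<phi> r (chi x) = 0"
    using assms(2)[OF x] r by (simp add: leavitt_compatible_def)
qed

text \<open>Induction over the generation of the ideal. The vector must vary: in a product
  \<open>a * x\<close> the factor \<open>x\<close> acts first, and \<open>a\<close> then meets a new
  vector, still supported on \<open>X\<close>.\<close>

lemma free_act_leavitt_ideal:
  assumes "leavitt_compatible Q X \<phi>" "a \<in> leavitt_ideal Q" "f \<in> supported_on X"
  shows "free_act \<phi> a f = 0"
  using assms(2,3)
proof (induction arbitrary: f)
  case (ideal_rel r)
  have "free_act \<phi> r f = free_act \<phi> r (lin_ext chi f)"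
    by (simp add: lin_ext_chi_eq)
  also have "\<dots> = lin_ext (\<lambda>x. free_act \<phi> r (chi x)) f"
    by (rule lin_ext_compose[OF module_hom_free_act])
  also have "\<dots> = lin_ext (\<lambda>x. 0) f"
    using assms(1) ideal_rel by (intro lin_ext_cong) (auto simp: leavitt_compatible_def)
  finally show ?case
    by (simp add: lin_ext_def)
next
  case (ideal_mult_right x a)
  have "free_act \<phi> x f \<in> supported_on X"
    using assms(1) ideal_mult_right by (intro free_act_in_supported_on) (auto simp: leavitt_compatible_def)
  with ideal_mult_right show ?case
    by (simp add: free_act_mult)
qed (simp_all add: free_act_zero free_act_add free_act_scale free_act_mult
    module_hom.zero[OF module_hom_free_act])

section \<open>Representations determined by generator actions\<close>

text \<open>
  A representation is pinned down by its values on classes of elements of the free algebra;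
  \<^const>\<open>act\<close> may take any value elsewhere.
\<close>

definition acts_via ::
  "('v, 'a) pre_digraph \<Rightarrow> ('v, 'a, 'k::field, 'x \<Rightarrow>\<^sub>0 'k) repr \<Rightarrow> 'x set
     \<Rightarrow> (('v, 'a) gen \<Rightarrow> 'x \<Rightarrow> 'x \<Rightarrow>\<^sub>0 'k) \<Rightarrow> bool" where
  "acts_via Q M X \<phi> \<longleftrightarrow> vscale M = fscale \<and> vspace M = supported_on X \<and>
     (\<forall>a\<in>free_carrier Q. act M (leavitt_class Q a) = restrict (free_act \<phi> a) (supported_on X))"

text \<open>Two representatives of a class differ by an element of the ideal, which acts by zero. So
  \<open>the_elem\<close> is applied to a singleton and returns the action of any
  representative.\<close>

lemma acts_via_basis_rep:
  assumes "leavitt_compatible Q X \<phi>"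
  shows "acts_via Q (basis_rep X \<phi>) X \<phi>"
proof -
  have "act (basis_rep X \<phi>) (leavitt_class Q a) = restrict (free_act \<phi> a) (supported_on X)"
    if a: "a \<in> free_carrier Q" for a
  proof -
    have "restrict (free_act \<phi> b) (supported_on X) = restrict (free_act \<phi> a) (supported_on X)"
      if "b \<in> leavitt_class Q a" for b
      using that free_act_leavitt_ideal[OF assms, of "a - b"]
      by (intro restrict_ext) (simp add: leavitt_rel_def free_act_diff)
    moreover have "a \<in> leavitt_class Q a"
      using a by (rule equiv_class_self[OF equiv_leavitt_rel])
    ultimately have "(\<lambda>b. restrict (free_act \<phi> b) (supported_on X)) ` leavitt_class Q a
        = {restrict (free_act \<phi> a) (supported_on X)}"
      by blast
    then show ?thesis
      by (simp add: basis_rep_def)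
  qed
  then show ?thesis
    by (simp add: acts_via_def basis_rep_def)
qed

lemma acts_via_subrep:
  fixes \<phi> :: "('v, 'a) gen \<Rightarrow> 'x \<Rightarrow> 'x \<Rightarrow>\<^sub>0 'k::field"
  assumes "acts_via Q M X \<phi>" "Y \<subseteq> X"
  shows "acts_via Q (subrep M (supported_on Y)) Y \<phi>"
proof -
  have "supported_on X \<inter> supported_on Y = (supported_on Y :: ('x \<Rightarrow>\<^sub>0 'k) set)"
    using assms(2) by blast
  with assms(1) show ?thesis
    by (simp add: acts_via_def subrep_def)
qed

lemma acts_via_cong:
  assumes "acts_via Q M X \<phi>" "leavitt_compatible Q X \<psi>"
    and "\<And>g x. g \<in> gens Q \<Longrightarrow> x \<in> X \<Longrightarrow> \<phi> g x = \<psi> g x"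
  shows "acts_via Q M X \<psi>"
proof -
  have "free_act \<phi> a f = free_act \<psi> a f" if "a \<in> free_carrier Q" "f \<in> supported_on X" for a f
    using assms(2,3) that
    by (intro free_act_cong[where X = X and Q = Q]) (auto simp: leavitt_compatible_def)
  then have "restrict (free_act \<phi> a) (supported_on X) = restrict (free_act \<psi> a) (supported_on X)"
    if "a \<in> free_carrier Q" for a
    using that by (intro restrict_ext)
  with assms(1) show ?thesis
    by (simp add: acts_via_def)
qed

lemma acts_via_is_representation:
  fixes \<phi> :: "('v, 'a) gen \<Rightarrow> 'x \<Rightarrow> 'x \<Rightarrow>\<^sub>0 'k::field"
  assumes "acts_via Q M X \<phi>" "leavitt_compatible Q X \<phi>"
  shows "is_representation Q M"
proof -
  have closed: "Poly_Mapping.keys (free_act \<phi> a f) \<subseteq> X"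
    if "a \<in> free_carrier Q" "Poly_Mapping.keys f \<subseteq> X" for a f
    using free_act_in_supported_on[of Q X \<phi> a f] assms(2) that by (auto simp: leavitt_compatible_def)
  have sum: "Poly_Mapping.keys (f + g) \<subseteq> X"
    if "Poly_Mapping.keys f \<subseteq> X" "Poly_Mapping.keys g \<subseteq> X" for f g :: "'x \<Rightarrow>\<^sub>0 'k"
    using that fscale.subspace_add[OF subspace_supported_on, of f X g] by simp
  have scale: "Poly_Mapping.keys (fscale c f) \<subseteq> X"
    if "Poly_Mapping.keys f \<subseteq> X" for f :: "'x \<Rightarrow>\<^sub>0 'k" and c
    using that fscale.subspace_scale[OF subspace_supported_on, of f X c] by simp
  have act: "act M (leavitt_class Q a) = restrict (free_act \<phi> a) (supported_on X)"
    if "a \<in> free_carrier Q" for a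
    using that assms(1) by (simp add: acts_via_def)
  have "algebra_hom (leavitt_path_algebra Q) (End_algebra fscale (supported_on X)) (act M)"
    unfolding algebra_hom_def Pi_iff ball_leavitt_path_algebra
  proof (intro conjI ballI allI)
    fix a :: "('v, 'a, 'k) free_alg" assume a: "a \<in> free_carrier Q"
    show "act M (leavitt_class Q a) \<in> acarrier (End_algebra fscale (supported_on X))"
      by (simp add: act a End_algebra_def linear_between_def closed sum scale
          module_hom.add[OF module_hom_free_act] module_hom.scale[OF module_hom_free_act])
    show "act M (ascale (leavitt_path_algebra Q) c (leavitt_class Q a)) =
        ascale (End_algebra fscale (supported_on X)) c (act M (leavitt_class Q a))" for c
      using a by (auto simp: leavitt_class_scale act free_carrier_scale End_algebra_def free_act_scale
          intro!: restrict_ext)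
    fix b :: "('v, 'a, 'k) free_alg" assume b: "b \<in> free_carrier Q"
    show "act M (aadd (leavitt_path_algebra Q) (leavitt_class Q a) (leavitt_class Q b)) =
        aadd (End_algebra fscale (supported_on X)) (act M (leavitt_class Q a)) (act M (leavitt_class Q b))"
      using a b by (auto simp: leavitt_class_add act free_carrier_add End_algebra_def free_act_add
          intro!: restrict_ext)
    \<comment> \<open>Composing the restricted maps gives the restricted composite because
      \<open>closed\<close> keeps the inner value in the space.\<close>
    show "act M (amult (leavitt_path_algebra Q) (leavitt_class Q a) (leavitt_class Q b)) =
        amult (End_algebra fscale (supported_on X)) (act M (leavitt_class Q a)) (act M (leavitt_class Q b))"
      using a b by (auto simp: leavitt_class_mult act free_carrier_mult End_algebra_def free_act_mult
          compose_def closed intro!: restrict_ext)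
  qed
  then show ?thesis
    using assms(1)
    by (simp add: is_representation_def acts_via_def fscale.vector_space_axioms subspace_supported_on)
qed

lemma acts_via_isomorphic_reps:
  assumes "acts_via Q M X \<phi>" "acts_via Q N X \<phi>" "leavitt_compatible Q X \<phi>"
  shows "isomorphic_reps Q M N"
proof -
  have "rep_iso Q M N id"
    using assms(1,2) by (simp add: rep_iso_def acts_via_def linear_between_def ball_leavitt_path_algebra)
  then show ?thesis
    using assms acts_via_is_representation by (auto simp: isomorphic_reps_def)
qed

section \<open>Branching systems\<close>

text \<open>The relations mirror the axioms. Orthogonality of vertices is disjointness of the vertex
  sets; the four relations at the ends of an arrow express the domain and range of \<sigma> and the
  inclusion of arrow sets in vertex sets. \<open>rel_CK1\<close> is injectivity of \<sigma> with
  disjointness of arrow sets, and \<open>rel_CK2\<close> is the covering axiom with that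
  disjointness.\<close>

lemma leavitt_compatible_M_gen:
  fixes X :: "('v, 'a, 'x) branching"
  assumes "wf_digraph Q" "algebraic_branching_system Q X"
  shows "leavitt_compatible Q (bset X) (M_gen Q X :: _ \<Rightarrow> _ \<Rightarrow> _ \<Rightarrow>\<^sub>0 'k::field)"
proof -
  note [simp] = wf_digraph.head_in_verts[OF assms(1)] wf_digraph.tail_in_verts[OF assms(1)]
  have sub: "\<forall>i\<in>verts Q. bvert X i \<subseteq> bset X"
    and sub': "\<forall>\<alpha>\<in>arcs Q. barr X \<alpha> \<subseteq> bset X" "\<forall>\<alpha>\<in>arcs Q. barr X \<alpha> \<subseteq> bvert X (tail Q \<alpha>)"
    and bij: "\<forall>\<alpha>\<in>arcs Q. bij_betw (bmap X \<alpha>) (bvert X (head Q \<alpha>)) (barr X \<alpha>)"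
    and disj: "\<forall>i\<in>verts Q. \<forall>j\<in>verts Q. i \<noteq> j \<longrightarrow> bvert X i \<inter> bvert X j = {}"
    and disj': "\<forall>\<alpha>\<in>arcs Q. \<forall>\<beta>\<in>arcs Q. \<alpha> \<noteq> \<beta> \<longrightarrow> barr X \<alpha> \<inter> barr X \<beta> = {}"
    and cover: "\<forall>i. regular Q i \<longrightarrow> bvert X i = (\<Union>\<alpha>\<in>out_arcs Q i. barr X \<alpha>)"
    using assms(2) unfolding algebraic_branching_system_def by simp_all
  note sub = bspec[OF sub] and sub' = sub'[THEN bspec] and bij = bspec[OF bij]
    and cover = cover[rule_format]
  have disj: "i = j" if "i \<in> verts Q" "j \<in> verts Q" "x \<in> bvert X i" "x \<in> bvert X j" for i j x
    using disj that by blast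
  have disj': "\<alpha> = \<beta>" if "\<alpha> \<in> arcs Q" "\<beta> \<in> arcs Q" "x \<in> barr X \<alpha>" "x \<in> barr X \<beta>" for \<alpha> \<beta> x
    using disj' that by blast
  define inv where "inv \<alpha> = inv_into (bvert X (head Q \<alpha>)) (bmap X \<alpha>)" for \<alpha>
  have inv_in: "inv \<alpha> x \<in> bvert X (head Q \<alpha>)" and map_inv: "bmap X \<alpha> (inv \<alpha> x) = x"
    if "\<alpha> \<in> arcs Q" "x \<in> barr X \<alpha>" for \<alpha> x
    unfolding inv_def using bij[OF that(1)] that(2)
    by (blast intro: bij_betw_apply[OF bij_betw_inv_into], rule bij_betw_inv_into_right)
  have map_in: "bmap X \<alpha> x \<in> barr X \<alpha>" and inv_map: "inv \<alpha> (bmap X \<alpha> x) = x"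
    if "\<alpha> \<in> arcs Q" "x \<in> bvert X (head Q \<alpha>)" for \<alpha> x
    unfolding inv_def using bij[OF that(1)] that(2)
    by (rule bij_betw_apply, rule bij_betw_inv_into_left)
  have gen: "(M_gen Q X g x :: _ \<Rightarrow>\<^sub>0 'k) \<in> supported_on (bset X)" if "g \<in> gens Q" "x \<in> bset X" for g x
  proof (cases g)
    case (Arr \<alpha>)
    then have "\<alpha> \<in> arcs Q"
      using that(1) by (auto simp: gens_def)
    with Arr show ?thesis
      using inv_in[of \<alpha> x] sub[of "head Q \<alpha>"] by (auto simp: inv_def)
  next
    case (Ghost \<alpha>)
    then have "\<alpha> \<in> arcs Q"
      using that(1) by (auto simp: gens_def)
    with Ghost show ?thesis
      using map_in[of \<alpha> x] sub'(1)[of \<alpha>] by auto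
  qed (use that(2) in simp)
  have rel: "free_act (M_gen Q X) r (chi x) = 0"
    if "r \<in> relators Q" "x \<in> bset X" for r :: "('v, 'a, 'k) free_alg" and x
    using that(1)
  proof cases
    case (rel_vert i j)
    then show ?thesis
      using disj[of i j x] by (auto simp: free_act_diff free_act_mon free_act_zero)
  next
    case (rel_arr_left \<alpha>)
    then show ?thesis
      using inv_in[of \<alpha> x] by (auto simp: free_act_diff free_act_mon inv_def)
  next
    case (rel_arr_right \<alpha>)
    then show ?thesis
      using sub'(2)[of \<alpha>] by (auto simp: free_act_diff free_act_mon)
  next
    case (rel_ghost_left \<alpha>)
    then show ?thesis
      using sub'(2)[of \<alpha>] map_in[of \<alpha> x] by (auto simp: free_act_diff free_act_mon)
  next
    case (rel_ghost_right \<alpha>)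
    then show ?thesis
      by (auto simp: free_act_diff free_act_mon)
  next
    case (rel_CK1 \<alpha> \<beta>)
    then show ?thesis
      using disj'[of \<alpha> \<beta> "bmap X \<beta> x"] map_in[of \<beta> x] inv_map[of \<beta> x]
      by (auto simp: free_act_diff free_act_mon free_act_zero inv_def)
  next
    case (rel_CK2 i)
    \<comment> \<open>Undoing \<sigma> and applying it again projects onto the span of the arrow
      set.\<close>
    have summand: "word_act (M_gen Q X) [Ghost \<alpha>, Arr \<alpha>] (chi x) =
        (if x \<in> barr X \<alpha> then chi x else 0 :: 'x \<Rightarrow>\<^sub>0 'k)"
      if "\<alpha> \<in> out_arcs Q i" for \<alpha>
      using that inv_in[of \<alpha> x] map_inv[of \<alpha> x] by (auto simp: inv_def)
    \<comment> \<open>A regular vertex is no infinite emitter; over an infinite index set the sum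
      would be 0 by convention.\<close>
    have fin: "finite (out_arcs Q i)"
      using rel_CK2(2) by (simp add: regular_def infinite_emitter_def)
    have "(\<Sum>\<alpha>\<in>out_arcs Q i. if x \<in> barr X \<alpha> then chi x else 0 :: 'x \<Rightarrow>\<^sub>0 'k)
        = M_gen Q X (Vert i) x"
    proof (cases "x \<in> bvert X i")
      case True
      then obtain \<beta> where \<beta>: "\<beta> \<in> out_arcs Q i" "x \<in> barr X \<beta>"
        using cover[OF rel_CK2(2)] by blast
      \<comment> \<open>Covering gives one arrow set containing \<open>x\<close>, disjointness
        excludes all others, so a single summand survives.\<close>
      have "x \<in> barr X \<alpha> \<longleftrightarrow> \<alpha> = \<beta>" if "\<alpha> \<in> out_arcs Q i" for \<alpha>
        using that \<beta> disj'[of \<alpha> \<beta> x] by auto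
      then have "(\<Sum>\<alpha>\<in>out_arcs Q i. if x \<in> barr X \<alpha> then chi x else 0)
          = (\<Sum>\<alpha>\<in>out_arcs Q i. if \<alpha> = \<beta> then chi x else 0 :: 'x \<Rightarrow>\<^sub>0 'k)"
        by (intro sum.cong refl if_cong)
      also have "\<dots> = chi x"
        using \<beta>(1) fin by simp
      finally show ?thesis
        using True by simp
    next
      case False
      then have "x \<notin> barr X \<alpha>" if "\<alpha> \<in> out_arcs Q i" for \<alpha>
        using cover[OF rel_CK2(2)] that by blast
      with False show ?thesis
        by (simp add: sum.neutral)
    qed
    moreover have "free_act (M_gen Q X) r (chi x) =
        (\<Sum>\<alpha>\<in>out_arcs Q i. word_act (M_gen Q X) [Ghost \<alpha>, Arr \<alpha>] (chi x)) - M_gen Q X (Vert i) x"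
      unfolding rel_CK2(1) free_act_diff free_act_sum free_act_mon by simp
    ultimately show ?thesis
      using summand by (simp only: sum.cong[OF refl summand] diff_self)
  qed
  from gen rel show ?thesis
    by (simp add: leavitt_compatible_def)
qed

text \<open>
  On a branching system contained in \<open>X\<close> whose maps are those of \<open>\<phi>\<close>, the identity is the
  required isomorphism; that \<open>\<phi>\<close> is compatible with the Leavitt relations on all of \<open>X\<close> follows
  because \<open>X\<close> is covered by such branching systems.
\<close>

lemma isomorphic_reps_covered:
  assumes "wf_digraph Q"
    and "\<And>x. x \<in> X \<Longrightarrow> \<exists>B. x \<in> bset B \<and> B \<in> \<B>"
    and "\<And>B. B \<in> \<B> \<Longrightarrow> algebraic_branching_system Q B \<and> bset B \<subseteq> X"
    and "\<And>B g x. B \<in> \<B> \<Longrightarrow> g \<in> gens Q \<Longrightarrow> x \<in> bset B \<Longrightarrow> \<phi> g x = M_gen Q B g x"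
    and "B \<in> \<B>"
  shows "isomorphic_reps Q (subrep (basis_rep X \<phi>) (fscale.span (chi ` bset B))) (M_rep Q B)"
proof -
  \<comment> \<open>For each basis element, choose a branching system of the cover that contains
    it.\<close>
  obtain C where C: "\<And>x. x \<in> X \<Longrightarrow> x \<in> bset (C x) \<and> C x \<in> \<B>"
    using assms(2) by metis
  have compat: "leavitt_compatible Q (bset B) (M_gen Q B)" if "B \<in> \<B>" for B
    using leavitt_compatible_M_gen[OF assms(1)] assms(3)[OF that] by blast
  have "leavitt_compatible Q X \<phi>"
    using C assms(3,4) compat
    by (intro leavitt_compatible_local[OF assms(1), where Y = "\<lambda>x. bset (C x)" and \<psi> = "\<lambda>x. M_gen Q (C x)"])
       blast+
  then have "acts_via Q (subrep (basis_rep X \<phi>) (supported_on (bset B))) (bset B) \<phi>"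
    using assms(3,5) by (intro acts_via_subrep[OF acts_via_basis_rep]) auto
  \<comment> \<open>On \<open>bset B\<close> the two generator actions coincide, so the
    subrepresentation and \<open>M_rep Q B\<close> are given by the same data.\<close>
  then have "acts_via Q (subrep (basis_rep X \<phi>) (supported_on (bset B))) (bset B) (M_gen Q B)"
    by (rule acts_via_cong[OF _ compat[OF assms(5)]]) (use assms(4,5) in auto)
  moreover have "acts_via Q (M_rep Q B) (bset B) (M_gen Q B)"
    unfolding M_rep_def by (rule acts_via_basis_rep[OF compat[OF assms(5)]])
  ultimately show ?thesis
    using acts_via_isomorphic_reps[OF _ _ compat[OF assms(5)]] by (simp add: span_chi)
qed

section \<open>Path representations compared with their branching systems\<close>

lemma F_gen_eq_M_gen:
  assumes "q \<in> tail_class Q p"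
  shows "F_gen Q g q = M_gen Q (class_branching Q p) g q"
proof (cases g)
  case (Arr \<alpha>)
  \<comment> \<open>The preimage \<open>stl q\<close> stays in the tail class and starts at the head
    of the removed arrow, by \<open>tail_class_Cons\<close>.\<close>
  have "inv_into {q \<in> tail_class Q p. tail Q (shd q) = head Q \<alpha>} ((##) \<alpha>) q = stl q" if "shd q = \<alpha>"
    using that assms tail_class_Cons[of "shd q" "stl q" Q p]
    by (intro inv_into_f_eq) (auto simp: inj_on_def)
  with Arr assms show ?thesis
    by (auto simp: class_branching_def)
qed (use assms in \<open>auto simp: class_branching_def\<close>)

lemma N_gen_eq_M_gen:
  assumes "wf_digraph Q" "q \<in> finite_paths_to Q i"
  shows "N_gen Q g q = M_gen Q (sink_branching Q i) g q"
proof -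
  obtain v as where q: "q = (v, as)"
    by fastforce
  show ?thesis
  proof (cases g)
    case (Arr \<alpha>)
    show ?thesis
    proof (cases as)
      case (Cons \<beta> bs)
      \<comment> \<open>The map discards the first component of a path; it is injective here because
        that component is fixed on its domain. A trivial path lies in no arrow set, so there both
        sides are 0.\<close>
      have "inv_into {q \<in> finite_paths_to Q i. fst q = head Q \<beta>} (\<lambda>q. (tail Q \<beta>, \<beta> # snd q)) q
          = (head Q \<beta>, bs)"
        using assms(2) by (intro inv_into_f_eq) (auto simp: q Cons inj_on_def finite_paths_to_Cons[OF assms(1)])
      with Arr Cons assms(2) show ?thesis
        by (auto simp: sink_branching_def q)
    qed (use Arr q in \<open>simp add: sink_branching_def\<close>)
  qed (use assms(2) q in \<open>auto simp: sink_branching_def\<close>)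
qed

theorem proposition5p3:
  fixes Q :: "('v, 'a) pre_digraph"
  assumes "wf_digraph Q"
  shows "(\<forall>p \<in> left_infinite_paths Q.
            isomorphic_reps Q
              (F_class Q p :: ('v, 'a, 'k::field, 'a stream \<Rightarrow>\<^sub>0 'k) repr)
              (M_rep Q (class_branching Q p) :: ('v, 'a, 'k, 'a stream \<Rightarrow>\<^sub>0 'k) repr)) \<and>
         (\<forall>i. is_sink Q i \<longrightarrow>
            isomorphic_reps Q
              (N_at Q i :: ('v, 'a, 'k, ('v, 'a) fpath \<Rightarrow>\<^sub>0 'k) repr)
              (M_rep Q (sink_branching Q i) :: ('v, 'a, 'k, ('v, 'a) fpath \<Rightarrow>\<^sub>0 'k) repr))"
proof (intro conjI ballI allI impI)
  fix p assume "p \<in> left_infinite_paths Q"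
  have "isomorphic_reps Q
      (subrep (basis_rep (left_infinite_paths Q) (F_gen Q)) (fscale.span (chi ` bset (class_branching Q p))))
      (M_rep Q (class_branching Q p) :: ('v, 'a, 'k, 'a stream \<Rightarrow>\<^sub>0 'k) repr)"
  \<comment> \<open>The cover consists of all tail classes, each path lying in its own.\<close>
  proof (rule isomorphic_reps_covered[OF assms, where \<B> = "range (class_branching Q)"])
    fix q assume "q \<in> left_infinite_paths Q"
    then have "q \<in> bset (class_branching Q q)"
      by (auto simp: class_branching_def tail_class_def tail_equivalent_def)
    then show "\<exists>B. q \<in> bset B \<and> B \<in> range (class_branching Q)"
      by blast
  next
    show "algebraic_branching_system Q B \<and> bset B \<subseteq> left_infinite_paths Q"
      if "B \<in> range (class_branching Q)" for B
      using that class_branching_system[OF assms] by (auto simp: class_branching_def tail_class_def)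
    show "F_gen Q g q = M_gen Q B g q"
      if B: "B \<in> range (class_branching Q)" "g \<in> gens Q" and q: "q \<in> bset B" for B g q
    proof -
      obtain p where p: "B = class_branching Q p"
        using B by blast
      show ?thesis
        using q unfolding p
        by (intro F_gen_eq_M_gen) (simp add: class_branching_def)
    qed
  qed simp
  then show "isomorphic_reps Q
      (F_class Q p :: ('v, 'a, 'k, 'a stream \<Rightarrow>\<^sub>0 'k) repr) (M_rep Q (class_branching Q p))"
    by (simp add: F_class_def F_rep_def class_branching_def)
next
  fix i assume i: "is_sink Q i"
  have "isomorphic_reps Q
      (subrep (basis_rep (sink_paths Q) (N_gen Q)) (fscale.span (chi ` bset (sink_branching Q i))))
      (M_rep Q (sink_branching Q i) :: ('v, 'a, 'k, ('v, 'a) fpath \<Rightarrow>\<^sub>0 'k) repr)"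
  \<comment> \<open>The cover is indexed by sinks: at a regular vertex, the trivial path would
    violate the covering axiom.\<close>
  proof (rule isomorphic_reps_covered[OF assms, where \<B> = "sink_branching Q ` {i. is_sink Q i}"])
    fix q assume "q \<in> sink_paths Q"
    then obtain j where "is_sink Q j" "q \<in> finite_paths_to Q j"
      by (auto simp: sink_paths_def)
    then have "q \<in> bset (sink_branching Q j)" "sink_branching Q j \<in> sink_branching Q ` {i. is_sink Q i}"
      by (auto simp: sink_branching_def)
    then show "\<exists>B. q \<in> bset B \<and> B \<in> sink_branching Q ` {i. is_sink Q i}"
      by blast
  next
    show "algebraic_branching_system Q B \<and> bset B \<subseteq> sink_paths Q"
      if "B \<in> sink_branching Q ` {i. is_sink Q i}" for B
      using that sink_branching_system[OF assms] by (auto simp: sink_branching_def sink_paths_def)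
    show "N_gen Q g q = M_gen Q B g q"
      if B: "B \<in> sink_branching Q ` {i. is_sink Q i}" "g \<in> gens Q" and q: "q \<in> bset B" for B g q
    proof -
      obtain j where j: "B = sink_branching Q j"
        using B by blast
      show ?thesis
        using q unfolding j
        by (intro N_gen_eq_M_gen[OF assms]) (simp add: sink_branching_def)
    qed
  qed (use i in simp)
  \<comment> \<open>As \<open>i\<close> is a sink, all paths ending at \<open>i\<close> already
    belong to \<open>sink_paths Q\<close>.\<close>
  moreover have "sink_paths Q \<inter> finite_paths_to Q i = bset (sink_branching Q i)"
    using i by (auto simp: sink_paths_def sink_branching_def)
  ultimately show "isomorphic_reps Q
      (N_at Q i :: ('v, 'a, 'k, ('v, 'a) fpath \<Rightarrow>\<^sub>0 'k) repr) (M_rep Q (sink_branching Q i))"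
    by (simp add: N_at_def N_rep_def)
qed

end
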